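(* Let $u$ be a natural number and $\kappa$ a positive integer. Then $$[u]_{\kappa,\mathcal{R}(p^{-1},q^{-1})} = (\epsilon_1\epsilon_2)^{-u\kappa+\binom{\kappa+1}{2}}\,[u]_{\kappa,\mathcal{R}(p,q)},$$ $$[u]_{\mathcal{R}(p^{-1},q^{-1})}! = (\epsilon_1\epsilon_2)^{-\binom{u}{2}}\,[u]_{\mathcal{R}(p,q)}!,$$ and $$\begin{bmatrix} u\\ \kappa\end{bmatrix}_{\mathcal{R}(p^{-1},q^{-1})} = (\epsilon_1\epsilon_2)^{-\kappa(u-\kappa)}\begin{bmatrix} u\\ \kappa\end{bmatrix}_{\mathcal{R}(p,q)}.$$
   Context: Let $0<q<p\le 1$ be real numbers. For an integer $u$, $[u]_{\mathcal{R}(p,q)}:=\mathcal{R}(p^u,q^u)$ denotes the $\mathcal{R}(p,q)$-deformed number, where $\mathcal{R}$ is a given meromorphic function, and $[u]_{\mathcal{R}(p^{-1},q^{-1})}$ denotes the deformed number obtained when the parameters $(p,q)$ are replaced by $(p^{-1},q^{-1})$. (Only the following properties of these two families of complex numbers indexed by integers are used.) For either family, write $[\cdot]$ for short and define $[u]_{\kappa}:=\prod_{v=1}^{\kappa}[u-v+1]$, $[k]!:=[1][2]\cdots[k]$ with $[0]!:=1$, and $\begin{bmatrix}u\\ \kappa\end{bmatrix}:=[u]_\kappa/[\kappa]!$, the family being indicated by the subscript $\mathcal{R}(p,q)$ or $\mathcal{R}(p^{-1},q^{-1})$. Assume $[k]_{\mathcal{R}(p,q)}\ne 0$ for all integers $k\ge1$.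 Standing assumption: there are nonzero numbers $\epsilon_1=\Phi_1(p,q)$ and $\epsilon_2=\Phi_2(p,q)$ such that for every integer $u$, $$[u]_{\mathcal{R}(p^{-1},q^{-1})}=(\epsilon_1\epsilon_2)^{1-u}\,[u]_{\mathcal{R}(p,q)}.$$ *)

theory Defs
  imports "HOL-Analysis.Analysis"
begin

(* Holomorphy in two variables on open sets: real Frechet differentiability
   with a complex-linear derivative. *)
definition holomorphic2_on :: "(complex \<times> complex \<Rightarrow> complex) \<Rightarrow> (complex \<times> complex) set \<Rightarrow> bool"
  where "holomorphic2_on f S \<longleftrightarrow>
    (\<forall>z\<in>S. \<exists>f'. (f has_derivative f') (at z) \<and> (\<forall>c x y. f' (c * x, c * y) = c * f' (x, y)))"

(* Locally a quotient of holomorphic functions. Meromorphic functions are modelled as total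
   functions, so nothing is required of f at the zeros of the local denominator. *)
definition meromorphic2_on :: "(complex \<times> complex \<Rightarrow> complex) \<Rightarrow> (complex \<times> complex) set \<Rightarrow> bool"
  where "meromorphic2_on f S \<longleftrightarrow> open S \<and>
    (\<forall>z\<in>S. \<exists>U g h. open U \<and> connected U \<and> z \<in> U \<and> U \<subseteq> S \<and>
       holomorphic2_on g U \<and> holomorphic2_on h U \<and> (\<exists>w\<in>U. h w \<noteq> 0) \<and>
       (\<forall>w\<in>U. h w \<noteq> 0 \<longrightarrow> f w = g w / h w))"

definition node :: "real \<Rightarrow> real \<Rightarrow> int \<Rightarrow> complex \<times> complex"
  where "node p q u = (complex_of_real p powi u, complex_of_real q powi u)"

(* The function R may itself involve the parameters, as in R(x,y) = (x - y)/(p - q), which gives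
   [u] = (p^u - q^u)/(p - q). It is therefore a family R p q of functions, and replacing (p,q) by
   (1/p,1/q) also replaces R p q by R (1/p) (1/q). For a function not involving the parameters,
   [u] would become [-u] and the relation [u]' = (e1 e2)^(1-u) [u] would force (e1 e2)^2 = 1. *)
definition deformed :: "(real \<Rightarrow> real \<Rightarrow> complex \<times> complex \<Rightarrow> complex) \<Rightarrow> real \<Rightarrow> real \<Rightarrow> int \<Rightarrow> complex"
  where "deformed R p q u = R p q (node p q u)"

definition dfalling :: "(int \<Rightarrow> complex) \<Rightarrow> int \<Rightarrow> nat \<Rightarrow> complex"
  where "dfalling a u \<kappa> = (\<Prod>v=1..\<kappa>. a (u - int v + 1))"

definition dfact :: "(int \<Rightarrow> complex) \<Rightarrow> nat \<Rightarrow> complex"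
  where "dfact a k = (\<Prod>i=1..k. a (int i))"

definition dbinomial :: "(int \<Rightarrow> complex) \<Rightarrow> int \<Rightarrow> nat \<Rightarrow> complex"
  where "dbinomial a u \<kappa> = dfalling a u \<kappa> / dfact a \<kappa>"

end

theory Submission
  imports Defs
begin

text \<open>Write \<open>c\<close> for \<open>\<epsilon>\<^sub>1 * \<epsilon>\<^sub>2\<close>.
  Replacing the parameters by their inverses multiplies the factor with index m by c^(1 - m), so a
  product of such factors is multiplied by c to the sum of the exponents. For the falling product
  this sum is that of v - u over v = 1..\<kappa>, a triangular number minus u \<kappa>
  (\<open>dfalling_scaled\<close>); for the factorial it is that of 1 - i over i = 1..k
  (\<open>dfact_scaled\<close>). In the binomial quotient the two exponents are subtracted
  (\<open>dbinomial_scaled\<close>). Only the scaling relation and c \<noteq> 0 enter, so the lemmas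
  treat arbitrary sequences \<open>a\<close>, \<open>b\<close>.\<close>

lemma dfalling_scaled:
  assumes "c \<noteq> 0" and "\<And>m. b m = c powi (1 - m) * a m"
  shows "dfalling b u \<kappa> = c powi (- (u * int \<kappa>) + int ((\<kappa> + 1) choose 2)) * dfalling a u \<kappa>"
proof (induction \<kappa>)
  case 0
  show ?case by (simp add: dfalling_def numeral_2_eq_2)
next
  case (Suc k)
  \<comment> \<open>The last summand is the contribution Suc k - u of the new factor, left in the
    form in which the scaling relation produces it. Unfolding 2 as a successor exposes Pascal's
    rule.\<close>
  have exponent: "- (u * int (Suc k)) + int ((Suc k + 1) choose 2)
        = (- (u * int k) + int ((k + 1) choose 2)) + (1 - (u - int (Suc k) + 1))"
    by (simp add: numeral_2_eq_2 algebra_simps)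
  have step: "dfalling f u (Suc k) = dfalling f u k * f (u - int (Suc k) + 1)" for f
    by (simp add: dfalling_def)
  show ?case
    unfolding exponent power_int_add[OF disjI1[OF assms(1)]] step Suc.IH
      assms(2)[of "u - int (Suc k) + 1"]
    by (simp only: mult_ac)
qed

lemma dfact_scaled:
  assumes "c \<noteq> 0" and "\<And>m. b m = c powi (1 - m) * a m"
  shows "dfact b k = c powi (- int (k choose 2)) * dfact a k"
proof (induction k)
  case 0
  show ?case by (simp add: dfact_def numeral_2_eq_2)
next
  case (Suc k)
  have exponent: "- int (Suc k choose 2) = - int (k choose 2) + (1 - int (Suc k))"
    by (simp add: numeral_2_eq_2)
  show ?case
    \<comment> \<open>Keeping \<open>int (Suc k)\<close> folded lets the power split off here match
      the one from the scaling relation at the new index.\<close>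
    unfolding exponent power_int_add[OF disjI1[OF assms(1)]]
    using Suc.IH by (simp add: dfact_def assms(2) del: of_nat_Suc)
qed

text \<open>Consecutive triangular numbers fill a square; this produces the \<kappa>^2 in the
  exponent -\<kappa>(u - \<kappa>) of the binomial.\<close>

lemma choose_two_add_choose_two: "((k + 1) choose 2) + (k choose 2) = k * k"
  by (induction k) (simp_all add: numeral_2_eq_2)

lemma dbinomial_scaled:
  assumes "c \<noteq> 0" and "\<And>m. b m = c powi (1 - m) * a m"
  shows "dbinomial b u \<kappa> = c powi (- (int \<kappa> * (u - int \<kappa>))) * dbinomial a u \<kappa>"
proof -
  have "int ((\<kappa> + 1) choose 2) + int (\<kappa> choose 2) = int \<kappa> * int \<kappa>"
    by (metis choose_two_add_choose_two of_nat_add of_nat_mult)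
  \<comment> \<open>Exponent of the numerator minus exponent of the denominator.\<close>
  then have "- (int \<kappa> * (u - int \<kappa>))
        = (- (u * int \<kappa>) + int ((\<kappa> + 1) choose 2)) - (- int (\<kappa> choose 2))"
    by (simp add: algebra_simps)
  then have "c powi (- (int \<kappa> * (u - int \<kappa>)))
        = c powi (- (u * int \<kappa>) + int ((\<kappa> + 1) choose 2)) / c powi (- int (\<kappa> choose 2))"
    by (simp only: power_int_diff[OF disjI1[OF assms(1)]])
  then show ?thesis
    unfolding dbinomial_def dfalling_scaled[OF assms] dfact_scaled[OF assms] by simp
qed

theorem proposition3p4:
  fixes p q :: real
    and R :: "real \<Rightarrow> real \<Rightarrow> complex \<times> complex \<Rightarrow> complex"
    and D D' :: "(complex \<times> complex) set"
    and \<Phi>\<^sub>1 \<Phi>\<^sub>2 :: "real \<Rightarrow> real \<Rightarrow> complex"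
    and \<epsilon>\<^sub>1 \<epsilon>\<^sub>2 :: complex
    and u \<kappa> :: nat
  assumes "0 < q" and "q < p" and "p \<le> 1"
    and "meromorphic2_on (R p q) D" and "range (node p q) \<subseteq> D"
    and "meromorphic2_on (R (inverse p) (inverse q)) D'"
    and "range (node (inverse p) (inverse q)) \<subseteq> D'"
    and "\<And>k::int. k \<ge> 1 \<Longrightarrow> deformed R p q k \<noteq> 0"
    and "\<epsilon>\<^sub>1 = \<Phi>\<^sub>1 p q" and "\<epsilon>\<^sub>2 = \<Phi>\<^sub>2 p q" and "\<epsilon>\<^sub>1 \<noteq> 0" and "\<epsilon>\<^sub>2 \<noteq> 0"
    and "\<And>m::int. deformed R (inverse p) (inverse q) m
                     = (\<epsilon>\<^sub>1 * \<epsilon>\<^sub>2) powi (1 - m) * deformed R p q m"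
    and "\<kappa> \<ge> 1"
  shows "dfalling (deformed R (inverse p) (inverse q)) (int u) \<kappa>
           = (\<epsilon>\<^sub>1 * \<epsilon>\<^sub>2) powi (- (int u * int \<kappa>) + int ((\<kappa> + 1) choose 2))
             * dfalling (deformed R p q) (int u) \<kappa>
       \<and> dfact (deformed R (inverse p) (inverse q)) u
           = (\<epsilon>\<^sub>1 * \<epsilon>\<^sub>2) powi (- int (u choose 2)) * dfact (deformed R p q) u
       \<and> dbinomial (deformed R (inverse p) (inverse q)) (int u) \<kappa>
           = (\<epsilon>\<^sub>1 * \<epsilon>\<^sub>2) powi (- (int \<kappa> * (int u - int \<kappa>)))
             * dbinomial (deformed R p q) (int u) \<kappa>"
proof -
  have "\<epsilon>\<^sub>1 * \<epsilon>\<^sub>2 \<noteq> 0"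
    using assms by simp
  \<comment> \<open>The two premises shared by the scaling lemmas: the base is nonzero, and the
    standing assumption relates the two deformed families.\<close>
  note scaled = this assms(13)
  show ?thesis
    by (intro conjI dfalling_scaled[OF scaled] dfact_scaled[OF scaled] dbinomial_scaled[OF scaled])
qed

end
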